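(* Let $d\ge 5$ be an integer with $d\equiv 1\pmod 4$, put $d'=\lfloor d/4\rfloor$, let $k$ be a rational and $\varepsilon$ a positive real such that $$2\le k<2+\frac{1}{2d'-1}\qquad\text{and}\qquad \varepsilon k\sum_{j=0}^{d'-1}(k-1)^{2j}\ \ge\ 1.$$ If $G$ is a fractionally $k$-colorable graph and $W\subseteq V(G)$ is a set of vertices at pairwise distance at least $d$, then every fractional $(k+\varepsilon)$-precoloring of $W$ extends to a fractional $(k+\varepsilon)$-coloring of $G$.
   Context: A fractional $m$-coloring of a graph (real $m>0$) assigns to each vertex a measurable subset of $[0,m)$ of Lebesgue measure one so that adjacent vertices receive disjoint sets; a graph is fractionally $k$-colorable if it has a fractional $k$-coloring. A fractional $m$-precoloring of a vertex set $W$ assigns measurable subsets of $[0,m)$ of measure one to the vertices of $W$; it extends if some fractional $m$-coloring of the whole graph agrees with it on $W$. Graphs are finite. *)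

theory Defs
  imports "HOL-Analysis.Analysis"
begin

definition finite_simple_graph :: "'a set \<Rightarrow> ('a \<Rightarrow> 'a \<Rightarrow> bool) \<Rightarrow> bool" where
  "finite_simple_graph V E \<longleftrightarrow> finite V \<and>
     (\<forall>u v. E u v \<longrightarrow> u \<in> V \<and> v \<in> V \<and> u \<noteq> v \<and> E v u)"

definition walk_of_length :: "('a \<Rightarrow> 'a \<Rightarrow> bool) \<Rightarrow> nat \<Rightarrow> 'a \<Rightarrow> 'a \<Rightarrow> bool" where
  "walk_of_length E n u v \<longleftrightarrow> (u, v) \<in> ({(x, y). E x y} ^^ n)"

text \<open>Graph distance between u and v is at least d (infinite distance counts).\<close>
definition dist_at_least :: "('a \<Rightarrow> 'a \<Rightarrow> bool) \<Rightarrow> nat \<Rightarrow> 'a \<Rightarrow> 'a \<Rightarrow> bool" where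
  "dist_at_least E d u v \<longleftrightarrow> (\<forall>n<d. \<not> walk_of_length E n u v)"

definition frac_color_set :: "real \<Rightarrow> real set \<Rightarrow> bool" where
  "frac_color_set m S \<longleftrightarrow> S \<in> sets lebesgue \<and> S \<subseteq> {0..<m} \<and> emeasure lebesgue S = 1"

definition fractional_coloring :: "'a set \<Rightarrow> ('a \<Rightarrow> 'a \<Rightarrow> bool) \<Rightarrow> real \<Rightarrow> ('a \<Rightarrow> real set) \<Rightarrow> bool" where
  "fractional_coloring V E m f \<longleftrightarrow>
     (\<forall>v\<in>V. frac_color_set m (f v)) \<and> (\<forall>u v. E u v \<longrightarrow> f u \<inter> f v = {})"

definition fractionally_colorable :: "'a set \<Rightarrow> ('a \<Rightarrow> 'a \<Rightarrow> bool) \<Rightarrow> real \<Rightarrow> bool" where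
  "fractionally_colorable V E k \<longleftrightarrow> (\<exists>f. fractional_coloring V E k f)"

definition fractional_precoloring :: "'a set \<Rightarrow> real \<Rightarrow> ('a \<Rightarrow> real set) \<Rightarrow> bool" where
  "fractional_precoloring W m p \<longleftrightarrow> (\<forall>w\<in>W. frac_color_set m (p w))"

definition precoloring_extends :: "'a set \<Rightarrow> ('a \<Rightarrow> 'a \<Rightarrow> bool) \<Rightarrow> 'a set \<Rightarrow> real \<Rightarrow> ('a \<Rightarrow> real set) \<Rightarrow> bool" where
  "precoloring_extends V E W m p \<longleftrightarrow>
     (\<exists>f. fractional_coloring V E m f \<and> (\<forall>w\<in>W. f w = p w))"

end

theory Submission
  imports Defs
begin

text \<open>
  Put M = k + \<epsilon> and n = 2d', so that d = 2n + 1 and the balls of radius n around the vertices of W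
  are disjoint. A colouring f in [0,k) is first spread over [0,M) to sets g(v) of measure M/k that
  meet every set of a prescribed finite family in the proportion 1/k. Around w in W choose
  decreasing chains T_0 = p(w) \<supseteq> T_2 \<supseteq> \<dots> and T_1 \<supseteq> T_3 \<supseteq> \<dots> with T_0 and T_1 disjoint and T_n empty, and give a
  vertex v at distance i \<ge> 1 the set (g(v) - T_(i-1)) \<union> (T_i - g(v)). Its measure is at least one as
  soon as |T_(i-1)| \<le> \<epsilon> + (k - 1) |T_i|; solving this recursion backwards from |T_n| = 0 reaches
  |T_0| = 1 exactly when \<epsilon> (1 + (k-1) + \<dots> + (k-1)^(n-1)) \<ge> 1. The bound on k excludes short odd
  closed walks, hence edges between vertices at the same distance i < n from w.
\<close>

section \<open>Bounded subsets of the line with prescribed Lebesgue measure\<close>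

lemma lmeasurable_atLeastLessThan: "{a..<b::real} \<in> lmeasurable"
  by (intro bounded_set_imp_lmeasurable) auto

text \<open>Moving the cut from x to y adds at most a piece of the interval [x, y], so the function
  is 1-Lipschitz.\<close>

lemma measure_Int_atMost_continuous:
  fixes S :: "real set"
  assumes S: "S \<in> lmeasurable"
  shows "continuous_on UNIV (\<lambda>x. measure lebesgue (S \<inter> {..x}))"
proof -
  have meas: "S \<inter> {..x} \<in> lmeasurable" for x
    using S by (simp add: fmeasurable_Int_fmeasurable)
  have step: "\<bar>measure lebesgue (S \<inter> {..y}) - measure lebesgue (S \<inter> {..x})\<bar> \<le> y - x"
    if "x \<le> y" for x y :: real
  proof -
    have "measure lebesgue (S \<inter> {..y}) \<le> measure lebesgue (S \<inter> {..x} \<union> {x..y})"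
      using meas by (intro measure_mono_fmeasurable) (auto simp: fmeasurableD fmeasurable.Un)
    also have "\<dots> \<le> measure lebesgue (S \<inter> {..x}) + measure lebesgue {x..y}"
      using meas by (intro measure_Un_le) (auto simp: fmeasurableD)
    finally have "measure lebesgue (S \<inter> {..y}) \<le> measure lebesgue (S \<inter> {..x}) + (y - x)"
      using that by simp
    moreover have "measure lebesgue (S \<inter> {..x}) \<le> measure lebesgue (S \<inter> {..y})"
      using meas that by (intro measure_mono_fmeasurable) (auto simp: fmeasurableD)
    ultimately show ?thesis by simp
  qed
  have lip: "dist (measure lebesgue (S \<inter> {..x})) (measure lebesgue (S \<inter> {..y})) \<le> dist x y" for x y :: real
    using step[of x y] step[of y x] by (cases "x \<le> y") (auto simp: dist_real_def)
  show ?thesis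
    unfolding continuous_on_iff using lip by (metis dist_commute le_less_trans)
qed

text \<open>S is cut by half-lines, and the intermediate value theorem provides a cut point for each
  measure. Larger measures force larger cut points, so a single choice of cut points yields a nested
  family. The chains around a precoloured vertex need this nesting.\<close>

lemma nested_subsets_of_measure:
  fixes S :: "real set"
  assumes S: "S \<in> lmeasurable" and bdd: "S \<subseteq> {a..<b}"
  obtains cut :: "real \<Rightarrow> real set" where
    "\<And>c. 0 \<le> c \<Longrightarrow> c \<le> measure lebesgue S \<Longrightarrow>
       cut c \<subseteq> S \<and> cut c \<in> lmeasurable \<and> measure lebesgue (cut c) = c"
    "\<And>c c'. 0 \<le> c \<Longrightarrow> c \<le> c' \<Longrightarrow> c' \<le> measure lebesgue S \<Longrightarrow> cut c \<subseteq> cut c'"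
proof -
  define g where "g x = measure lebesgue (S \<inter> {..x})" for x
  have meas: "S \<inter> {..x} \<in> lmeasurable" for x
    using S by (simp add: fmeasurable_Int_fmeasurable)
  have mono: "g x \<le> g y" if "x \<le> y" for x y
    unfolding g_def using meas that by (intro measure_mono_fmeasurable) (auto simp: fmeasurableD)
  have "\<exists>x. g x = c" if "0 \<le> c" "c \<le> measure lebesgue S" for c
  proof -
    \<comment> \<open>The right end is \<open>max a b\<close> so that the interval is nonempty even
      if b < a, when S is empty.\<close>
    have "S \<inter> {..a - 1} = {}" "S \<inter> {..max a b} = S"
      using bdd by fastforce+
    then have "g (a - 1) = 0" "g (max a b) = measure lebesgue S"
      by (simp_all add: g_def)
    moreover have "continuous_on {a - 1..max a b} g"
      using measure_Int_atMost_continuous[OF S] unfolding g_def by (rule continuous_on_subset) simp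
    ultimately show ?thesis
      using IVT'[of g "a - 1" c "max a b"] that by (auto simp: max_def split: if_splits)
  qed
  then obtain X where X: "\<And>c. 0 \<le> c \<Longrightarrow> c \<le> measure lebesgue S \<Longrightarrow> g (X c) = c"
    by metis
  show ?thesis
  proof (rule that[of "\<lambda>c. S \<inter> {..X c}"])
    show "S \<inter> {..X c} \<subseteq> S \<and> S \<inter> {..X c} \<in> lmeasurable \<and> measure lebesgue (S \<inter> {..X c}) = c"
      if "0 \<le> c" "c \<le> measure lebesgue S" for c
      using X[OF that] meas by (auto simp: g_def)
    show "S \<inter> {..X c} \<subseteq> S \<inter> {..X c'}"
      if "0 \<le> c" "c \<le> c'" "c' \<le> measure lebesgue S" for c c'
    proof (cases "c = c'")
      case False
      then have "g (X c) < g (X c')" using X that by auto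
      then have "X c \<le> X c'" using mono by (meson linorder_le_cases not_less)
      then show ?thesis by auto
    qed simp
  qed
qed

lemma subset_of_measure:
  fixes S :: "real set"
  assumes "S \<in> lmeasurable" "S \<subseteq> {a..<b}" "0 \<le> c" "c \<le> measure lebesgue S"
  obtains B where "B \<subseteq> S" "B \<in> lmeasurable" "measure lebesgue B = c"
  using nested_subsets_of_measure[OF assms(1,2)] assms(3,4) by metis

lemma disjoint_subsets_of_measure:
  fixes S :: "real set"
  assumes "finite I" "S \<in> lmeasurable" "S \<subseteq> {a..<b}" "\<And>i. i \<in> I \<Longrightarrow> 0 \<le> c i"
    "sum c I \<le> measure lebesgue S"
  shows "\<exists>B. (\<forall>i\<in>I. B i \<subseteq> S \<and> B i \<in> lmeasurable \<and> measure lebesgue (B i) = c i) \<and>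
             (\<forall>i\<in>I. \<forall>j\<in>I. i \<noteq> j \<longrightarrow> B i \<inter> B j = {})"
  using assms
proof (induction I arbitrary: S rule: finite_induct)
  case (insert i I)
  have nonneg: "0 \<le> c i" "0 \<le> sum c I" using insert.prems by (auto intro: sum_nonneg)
  then have "c i \<le> measure lebesgue S" using insert by simp
  then obtain A where A: "A \<subseteq> S" "A \<in> lmeasurable" "measure lebesgue A = c i"
    using subset_of_measure[OF insert.prems(1,2) nonneg(1)] by blast
  have "S - A \<in> lmeasurable" using A insert.prems by (simp add: fmeasurable.Diff)
  moreover have "measure lebesgue (S - A) = measure lebesgue S - c i"
    using A insert.prems by (simp add: measurable_measure_Diff fmeasurableD)
  ultimately obtain B where
    B: "\<forall>j\<in>I. B j \<subseteq> S - A \<and> B j \<in> lmeasurable \<and> measure lebesgue (B j) = c j"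
      "\<forall>j\<in>I. \<forall>l\<in>I. j \<noteq> l \<longrightarrow> B j \<inter> B l = {}"
    using insert.IH[of "S - A"] insert.prems insert.hyps by (auto simp: Diff_subset[THEN subset_trans])
  show ?case
    using A B insert.hyps by (intro exI[of _ "B(i := A)"]) (auto; blast)
qed simp

section \<open>Atoms of the set algebra generated by finitely many sets, and
  equidistribution\<close>

definition atom :: "'b set \<Rightarrow> 'i set \<Rightarrow> ('i \<Rightarrow> 'b set) \<Rightarrow> 'i set \<Rightarrow> 'b set" where
  "atom C I A J = {x \<in> C. {i \<in> I. x \<in> A i} = J}"

lemma atom_lmeasurable:
  fixes C :: "real set"
  assumes "finite I" "C \<in> lmeasurable" "\<And>i. i \<in> I \<Longrightarrow> A i \<in> lmeasurable"
  shows "atom C I A J \<in> lmeasurable"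
proof (cases "J \<subseteq> I")
  case True
  have "atom C I A J = C - ((\<Union>i\<in>J. C - A i) \<union> (\<Union>i\<in>I - J. A i))"
    using True unfolding atom_def by blast
  moreover have "(\<Union>i\<in>J. C - A i) \<in> lmeasurable" "(\<Union>i\<in>I - J. A i) \<in> lmeasurable"
    using assms True finite_subset[OF True]
    by (intro fmeasurable.finite_UN fmeasurable.Diff; blast)+
  ultimately show ?thesis using assms by (auto intro!: fmeasurable.Diff fmeasurable.Un)
next
  case False
  then have "atom C I A J = {}" unfolding atom_def by blast
  then show ?thesis by simp
qed

lemma measure_eq_sum_atoms:
  fixes C :: "real set"
  assumes "finite I" "C \<in> lmeasurable" "\<And>i. i \<in> I \<Longrightarrow> A i \<in> lmeasurable \<and> A i \<subseteq> C" "i \<in> I"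
  shows "measure lebesgue (A i) = (\<Sum>J\<in>{J \<in> Pow I. i \<in> J}. measure lebesgue (atom C I A J))"
proof -
  have "A i = (\<Union>J\<in>{J \<in> Pow I. i \<in> J}. atom C I A J)"
  proof (rule equalityI; rule subsetI)
    fix x assume "x \<in> A i"
    then have "x \<in> atom C I A {i \<in> I. x \<in> A i}" "i \<in> {i \<in> I. x \<in> A i}"
      using assms(3)[OF assms(4)] assms(4) unfolding atom_def by blast+
    then show "x \<in> (\<Union>J\<in>{J \<in> Pow I. i \<in> J}. atom C I A J)"
      by (intro UN_I[of "{i \<in> I. x \<in> A i}"]) simp_all
  next
    fix x assume "x \<in> (\<Union>J\<in>{J \<in> Pow I. i \<in> J}. atom C I A J)"
    then obtain J where J: "i \<in> J" "x \<in> atom C I A J" by blast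
    then have "{i \<in> I. x \<in> A i} = J" by (simp add: atom_def)
    with J(1) show "x \<in> A i" by blast
  qed
  also have "measure lebesgue \<dots> = (\<Sum>J\<in>{J \<in> Pow I. i \<in> J}. measure lebesgue (atom C I A J))"
  proof (rule measure_UNION')
    show "finite {J \<in> Pow I. i \<in> J}" using assms(1) by simp
    show "atom C I A J \<in> lmeasurable" for J
      using assms(1-3) by (intro atom_lmeasurable) simp_all
    show "pairwise (\<lambda>J L. disjnt (atom C I A J) (atom C I A L)) {J \<in> Pow I. i \<in> J}"
      unfolding pairwise_def disjnt_def atom_def by blast
  qed
  finally show ?thesis .
qed

text \<open>Each atom of the family \<T> is divided among the indices in the proportions
  \<open>c i\<close>. A member of \<T> is a disjoint union of atoms, so it inherits these
  proportions.\<close>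

lemma equidistributed_disjoint_sets:
  fixes \<T> :: "real set set"
  assumes "finite \<T>" "\<And>T. T \<in> \<T> \<Longrightarrow> T \<in> lmeasurable \<and> T \<subseteq> {a..<b}"
    and "finite I" "\<And>i. i \<in> I \<Longrightarrow> 0 \<le> c i" "sum c I \<le> 1"
  obtains X where "\<And>i. i \<in> I \<Longrightarrow> X i \<in> lmeasurable \<and> X i \<subseteq> {a..<b}"
    "\<And>i j. i \<in> I \<Longrightarrow> j \<in> I \<Longrightarrow> i \<noteq> j \<Longrightarrow> X i \<inter> X j = {}"
    "\<And>i T. i \<in> I \<Longrightarrow> T \<in> \<T> \<Longrightarrow> measure lebesgue (X i \<inter> T) = c i * measure lebesgue T"
proof -
  let ?at = "atom {a..<b} \<T> (\<lambda>T. T)"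
  have at: "?at J \<in> lmeasurable" "?at J \<subseteq> {a..<b}" for J
    using assms by (auto intro!: atom_lmeasurable lmeasurable_atLeastLessThan) (auto simp: atom_def)
  have "\<exists>B. (\<forall>i\<in>I. B i \<subseteq> ?at J \<and> B i \<in> lmeasurable \<and> measure lebesgue (B i) = c i * measure lebesgue (?at J)) \<and>
             (\<forall>i\<in>I. \<forall>j\<in>I. i \<noteq> j \<longrightarrow> B i \<inter> B j = {})" for J
    using assms at mult_right_mono[OF assms(5), of "measure lebesgue (?at J)"]
    by (intro disjoint_subsets_of_measure[of _ _ a b]) (auto simp: sum_distrib_right)
  then obtain B where
    B: "\<And>i J. i \<in> I \<Longrightarrow> B J i \<subseteq> ?at J \<and> B J i \<in> lmeasurable \<and> measure lebesgue (B J i) = c i * measure lebesgue (?at J)"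
      and disj: "\<And>i j J. i \<in> I \<Longrightarrow> j \<in> I \<Longrightarrow> i \<noteq> j \<Longrightarrow> B J i \<inter> B J j = {}"
    by metis
  have at_inj: "J = J'" if "x \<in> ?at J" "x \<in> ?at J'" for x J J'
    using that by (auto simp: atom_def)
  show ?thesis
  proof (rule that[of "\<lambda>i. \<Union>J\<in>Pow \<T>. B J i"])
    fix i assume i: "i \<in> I"
    show "(\<Union>J\<in>Pow \<T>. B J i) \<in> lmeasurable \<and> (\<Union>J\<in>Pow \<T>. B J i) \<subseteq> {a..<b}"
      using assms(1) B[OF i] at(2) by (intro conjI fmeasurable.finite_UN) blast+
    fix T assume T: "T \<in> \<T>"
    have "x \<in> T \<longleftrightarrow> T \<in> J" if "x \<in> B J i" for x J
    proof -
      have "x \<in> ?at J" using B[OF i] that by blast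
      then show ?thesis using T by (auto simp: atom_def)
    qed
    then have "(\<Union>J\<in>Pow \<T>. B J i) \<inter> T = (\<Union>J\<in>{J \<in> Pow \<T>. T \<in> J}. B J i)"
      by blast
    also have "measure lebesgue \<dots> = (\<Sum>J\<in>{J \<in> Pow \<T>. T \<in> J}. measure lebesgue (B J i))"
    proof (rule measure_UNION')
      show "pairwise (\<lambda>J L. disjnt (B J i) (B L i)) {J \<in> Pow \<T>. T \<in> J}"
        using B[OF i] at_inj unfolding pairwise_def disjnt_def by blast
    qed (use assms(1) B[OF i] in auto)
    also have "\<dots> = c i * (\<Sum>J\<in>{J \<in> Pow \<T>. T \<in> J}. measure lebesgue (?at J))"
      using B[OF i] by (simp add: sum_distrib_left)
    also have "\<dots> = c i * measure lebesgue T"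
      using measure_eq_sum_atoms[where A = "\<lambda>T. T", OF assms(1) lmeasurable_atLeastLessThan assms(2) T] by simp
    finally show "measure lebesgue ((\<Union>J\<in>Pow \<T>. B J i) \<inter> T) = c i * measure lebesgue T" .
  next
    fix i j assume ij: "i \<in> I" "j \<in> I" "i \<noteq> j"
    have "x \<notin> B L j" if "x \<in> B J i" for x J L
    proof
      assume "x \<in> B L j"
      moreover have "J = L"
        using B[OF ij(1), of J] B[OF ij(2), of L] \<open>x \<in> B L j\<close> that at_inj[of x J L] by blast
      ultimately show False using disj[OF ij, of J] that by blast
    qed
    then show "(\<Union>J\<in>Pow \<T>. B J i) \<inter> (\<Union>J\<in>Pow \<T>. B J j) = {}" by blast
  qed
qed

text \<open>Every atom of f, a set J of vertices sharing some colours, is replaced by a set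
  \<open>X J\<close> of the same relative size, equidistributed with respect to \<T>. The copy of
  \<open>f v\<close> collects the \<open>X J\<close> with v in J. Vertices with disjoint f-sets
  share no nonempty atom, so their copies are disjoint as well.\<close>

lemma equidistributed_copy:
  fixes f :: "'a \<Rightarrow> real set" and \<T> :: "real set set"
  assumes "finite \<T>" "\<And>T. T \<in> \<T> \<Longrightarrow> T \<in> lmeasurable \<and> T \<subseteq> {a..<b}"
    and V: "finite V" "\<And>v. v \<in> V \<Longrightarrow> f v \<in> lmeasurable \<and> f v \<subseteq> {0..<k}" and k: "k > 0"
  obtains g where "\<And>v. v \<in> V \<Longrightarrow> g v \<in> lmeasurable \<and> g v \<subseteq> {a..<b}"
    "\<And>u v. u \<in> V \<Longrightarrow> v \<in> V \<Longrightarrow> f u \<inter> f v = {} \<Longrightarrow> g u \<inter> g v = {}"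
    "\<And>v T. v \<in> V \<Longrightarrow> T \<in> \<T> \<Longrightarrow>
       measure lebesgue (g v \<inter> T) = measure lebesgue (f v) / k * measure lebesgue T"
proof -
  let ?at = "atom {0..<k} V f"
  let ?c = "\<lambda>J. measure lebesgue (?at J) / k"
  have at: "?at J \<in> lmeasurable" for J
    using V by (intro atom_lmeasurable lmeasurable_atLeastLessThan) auto
  have "(\<Sum>J\<in>Pow V. measure lebesgue (?at J)) = measure lebesgue (\<Union>J\<in>Pow V. ?at J)"
    using V(1) at by (intro measure_UNION'[symmetric]) (auto simp: pairwise_def disjnt_def atom_def)
  also have "(\<Union>J\<in>Pow V. ?at J) = {0..<k}"
    by (auto simp: atom_def)
  finally have "sum ?c (Pow V) = 1"
    using k by (simp flip: sum_divide_distrib)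
  moreover have "0 \<le> ?c J" for J using k by simp
  ultimately obtain X where X: "\<And>J. J \<in> Pow V \<Longrightarrow> X J \<in> lmeasurable \<and> X J \<subseteq> {a..<b}"
    "\<And>J L. J \<in> Pow V \<Longrightarrow> L \<in> Pow V \<Longrightarrow> J \<noteq> L \<Longrightarrow> X J \<inter> X L = {}"
    "\<And>J T. J \<in> Pow V \<Longrightarrow> T \<in> \<T> \<Longrightarrow> measure lebesgue (X J \<inter> T) = ?c J * measure lebesgue T"
    using equidistributed_disjoint_sets[of \<T> a b "Pow V" ?c] assms by auto
  \<comment> \<open>Patterns with an empty atom must be dropped: their \<open>X J\<close> is null
    but possibly nonempty, which could destroy exact disjointness of the copies.\<close>
  define N where "N v = {J \<in> Pow V. v \<in> J \<and> ?at J \<noteq> {}}" for v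
  have N: "finite (N v)" for v using V(1) by (simp add: N_def)
  show ?thesis
  proof (rule that[of "\<lambda>v. \<Union>J\<in>N v. X J"])
    fix v assume v: "v \<in> V"
    show "(\<Union>J\<in>N v. X J) \<in> lmeasurable \<and> (\<Union>J\<in>N v. X J) \<subseteq> {a..<b}"
      using X(1) N[of v] by (intro conjI fmeasurable.finite_UN UN_least) (auto simp: N_def)
    fix T assume T: "T \<in> \<T>"
    have "(\<Union>J\<in>N v. X J) \<inter> T = (\<Union>J\<in>N v. X J \<inter> T)" by blast
    also have "measure lebesgue \<dots> = (\<Sum>J\<in>N v. measure lebesgue (X J \<inter> T))"
    proof (rule measure_UNION'[OF N])
      show "X J \<inter> T \<in> lmeasurable" if "J \<in> N v" for J
        using X(1)[of J] assms(2)[OF T] that by (auto simp: N_def)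
      show "pairwise (\<lambda>J L. disjnt (X J \<inter> T) (X L \<inter> T)) (N v)"
        using X(2) unfolding pairwise_def disjnt_def N_def by blast
    qed
    also have "\<dots> = (\<Sum>J\<in>N v. measure lebesgue (?at J)) / k * measure lebesgue T"
      using X(3) T by (simp add: N_def sum_distrib_right sum_divide_distrib)
    also have "(\<Sum>J\<in>N v. measure lebesgue (?at J)) = (\<Sum>J\<in>{J \<in> Pow V. v \<in> J}. measure lebesgue (?at J))"
      using V(1) by (intro sum.mono_neutral_left) (auto simp: N_def)
    also have "\<dots> = measure lebesgue (f v)"
      using V v by (intro measure_eq_sum_atoms[symmetric] lmeasurable_atLeastLessThan) auto
    finally show "measure lebesgue ((\<Union>J\<in>N v. X J) \<inter> T) = measure lebesgue (f v) / k * measure lebesgue T" .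
  next
    fix u v assume uv: "u \<in> V" "v \<in> V" "f u \<inter> f v = {}"
    have "J \<noteq> L" if "J \<in> N u" "L \<in> N v" for J L
      using that uv by (auto simp: N_def atom_def)
    then show "(\<Union>J\<in>N u. X J) \<inter> (\<Union>J\<in>N v. X J) = {}"
      using X(2) by (auto simp: N_def, blast)
  qed
qed

section \<open>Colour sets, walks, and the drift of a colouring along walks\<close>

lemma frac_color_set_iff:
  "frac_color_set m S \<longleftrightarrow> S \<in> lmeasurable \<and> S \<subseteq> {0..<m} \<and> measure lebesgue S = 1"
proof -
  have "emeasure lebesgue S = 1 \<longleftrightarrow> measure lebesgue S = 1" if "S \<in> lmeasurable"
    using that by (simp add: emeasure_eq_measure2)
  moreover have "S \<in> lmeasurable" if "S \<in> sets lebesgue" "emeasure lebesgue S = 1"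
    using that by (intro fmeasurableI) auto
  ultimately show ?thesis
    unfolding frac_color_set_def by (meson fmeasurableD)
qed

lemma walk_sym:
  assumes "finite_simple_graph V E" "walk_of_length E n u v"
  shows "walk_of_length E n v u"
  using assms(2) unfolding walk_of_length_def
proof (induction n arbitrary: v)
  case (Suc n)
  then obtain x where "(u, x) \<in> {(x, y). E x y} ^^ n" "E x v"
    by (auto elim: relpow_Suc_E)
  then have "(x, u) \<in> {(x, y). E x y} ^^ n" "(v, x) \<in> {(x, y). E x y}"
    using Suc.IH assms(1) by (auto simp: finite_simple_graph_def)
  then show ?case by (metis relpow_Suc_I2)
qed auto

lemma walk_trans:
  "walk_of_length E i u v \<Longrightarrow> walk_of_length E j v w \<Longrightarrow> walk_of_length E (i + j) u w"
  unfolding walk_of_length_def by (rule relpow_trans)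

lemma walk_1: "walk_of_length E 1 u v \<longleftrightarrow> E u v"
  by (simp add: walk_of_length_def)

lemma walk_0: "walk_of_length E 0 u v \<longleftrightarrow> u = v"
  by (auto simp: walk_of_length_def)

text \<open>
  If c, x, b is a path then f c and f b both lie in the complement of f x, of measure k - 1.
\<close>
lemma coloring_drift_even_walk:
  assumes G: "finite_simple_graph V E" and f: "fractional_coloring V E k f"
    and "a \<in> V" "walk_of_length E (2 * m) a b"
  shows "b \<in> V \<and> measure lebesgue (f b - f a) \<le> real m * (k - 2)"
  using assms(4)
proof (induction m arbitrary: b)
  case 0
  then show ?case using \<open>a \<in> V\<close> by (simp add: walk_0)
next
  case (Suc m)
  then obtain x c where w: "walk_of_length E (2 * m) a c" "E c x" "E x b"
    by (auto simp: walk_of_length_def elim!: relpow_Suc_E)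
  have V: "c \<in> V" "x \<in> V" "b \<in> V" using w G by (auto simp: finite_simple_graph_def)
  have col: "f v \<in> lmeasurable" "f v \<subseteq> {0..<k}" "measure lebesgue (f v) = 1" if "v \<in> V" for v
    using f that by (auto simp: fractional_coloring_def frac_color_set_iff)
  have disj: "f c \<inter> f x = {}" "f x \<inter> f b = {}"
    using f w by (auto simp: fractional_coloring_def)
  have "f c \<union> f x \<subseteq> {0..<k}" using col V by blast
  \<comment> \<open>The edge from c to x supplies two disjoint sets of measure one. Hence [0,k) is
    nonempty and its measure is k, which the computation of the complement below requires.\<close>
  then have "1 + 1 \<le> k"
    using measure_mono_fmeasurable[of "f c \<union> f x" "{0..<k}" lebesgue] col V disj
      measure_Un3[of "f c" lebesgue "f x"] lmeasurable_atLeastLessThan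
    by (cases "k \<ge> 0") (auto simp: fmeasurableD)
  have step: "measure lebesgue (f b - f c) \<le> k - 2"
  proof -
    have "measure lebesgue (f b - f c) \<le> measure lebesgue ({0..<k} - (f c \<union> f x))"
    proof (rule measure_mono_fmeasurable)
      show "f b - f c \<subseteq> {0..<k} - (f c \<union> f x)" using col(2) V disj by blast
    qed (use col V lmeasurable_atLeastLessThan in \<open>auto intro!: fmeasurable.Diff fmeasurable.Un simp: fmeasurableD\<close>)
    also have "\<dots> = k - (1 + 1)"
      using col V disj lmeasurable_atLeastLessThan \<open>f c \<union> f x \<subseteq> {0..<k}\<close> \<open>1 + 1 \<le> k\<close>
        measure_Un3[of "f c" lebesgue "f x"]
      by (subst measurable_measure_Diff) (auto simp: fmeasurableD)
    finally show ?thesis by simp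
  qed
  have IH: "measure lebesgue (f c - f a) \<le> real m * (k - 2)" using Suc.IH w by auto
  have "measure lebesgue (f b - f a) \<le> measure lebesgue ((f b - f c) \<union> (f c - f a))"
    using col V \<open>a \<in> V\<close> by (intro measure_mono_fmeasurable) (auto intro!: fmeasurable.Diff fmeasurable.Un simp: fmeasurableD)
  also have "\<dots> \<le> measure lebesgue (f b - f c) + measure lebesgue (f c - f a)"
    using col V \<open>a \<in> V\<close> by (intro measure_Un_le) (auto simp: fmeasurableD)
  also have "\<dots> \<le> real (Suc m) * (k - 2)" using step IH by (simp add: algebra_simps)
  finally show ?case using V by simp
qed

section \<open>Chains of colour sets around one precoloured vertex\<close>

text \<open>As M \<ge> 2, a set Q of measure one fits into the complement of P. Even members are cut
  from P and odd ones from Q, each time by one nested family; consecutive members are then disjoint,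
  and members two apart are nested.\<close>

lemma alternating_nested_sets:
  fixes P :: "real set" and \<tau> :: "nat \<Rightarrow> real"
  assumes P: "P \<in> lmeasurable" "P \<subseteq> {0..<M}" "measure lebesgue P = 1" and M: "2 \<le> M"
    and \<tau>: "\<tau> 0 = 1" "antimono \<tau>" "\<And>i. 0 \<le> \<tau> i"
  obtains T where "T 0 = P"
    "\<And>i. T i \<in> lmeasurable \<and> T i \<subseteq> {0..<M} \<and> measure lebesgue (T i) = \<tau> i"
    "\<And>i. \<tau> i = 0 \<Longrightarrow> T i = {}" "\<And>i. T i \<inter> T (Suc i) = {}" "\<And>i. T (Suc (Suc i)) \<subseteq> T i"
proof -
  have \<tau>1: "\<tau> i \<le> 1" for i using \<tau> antimonoD[OF \<tau>(2), of 0 i] by simp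
  have dec: "\<tau> (Suc (Suc i)) \<le> \<tau> i" for i using \<tau> antimonoD[OF \<tau>(2), of i "Suc (Suc i)"] by simp
  have "{0..<M} - P \<in> lmeasurable" "{0..<M} - P \<subseteq> {0..<M}" "1 \<le> measure lebesgue ({0..<M} - P)"
    using P M lmeasurable_atLeastLessThan
    by (auto intro!: fmeasurable.Diff simp: measurable_measure_Diff fmeasurableD)
  then obtain Q where Q: "Q \<subseteq> {0..<M} - P" "Q \<in> lmeasurable" "measure lebesgue Q = 1"
    using subset_of_measure[of "{0..<M} - P" 0 M 1] by auto
  obtain cP where cP: "\<And>c. 0 \<le> c \<Longrightarrow> c \<le> 1 \<Longrightarrow> cP c \<subseteq> P \<and> cP c \<in> lmeasurable \<and> measure lebesgue (cP c) = c"
    "\<And>c c'. 0 \<le> c \<Longrightarrow> c \<le> c' \<Longrightarrow> c' \<le> 1 \<Longrightarrow> cP c \<subseteq> cP c'"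
    using nested_subsets_of_measure[OF P(1,2)] P(3) by metis
  have "Q \<subseteq> {0..<M}" using Q by auto
  then obtain cQ where cQ: "\<And>c. 0 \<le> c \<Longrightarrow> c \<le> 1 \<Longrightarrow> cQ c \<subseteq> Q \<and> cQ c \<in> lmeasurable \<and> measure lebesgue (cQ c) = c"
    "\<And>c c'. 0 \<le> c \<Longrightarrow> c \<le> c' \<Longrightarrow> c' \<le> 1 \<Longrightarrow> cQ c \<subseteq> cQ c'"
    using nested_subsets_of_measure[OF Q(2), of 0 M] Q(3) by metis
  \<comment> \<open>The two special cases repair null sets: \<open>cP 1\<close> may miss a null part
    of P, and \<open>cP 0\<close> or \<open>cQ 0\<close> may be null without being empty.\<close>
  define T where "T i = (if i = 0 then P else if \<tau> i = 0 then {} else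
      if even i then cP (\<tau> i) else cQ (\<tau> i))" for i
  have T_even: "T i \<subseteq> P" if "even i" for i
    using that cP(1)[OF \<tau>(3) \<tau>1] by (auto simp: T_def)
  have T_odd: "T i \<subseteq> Q" if "odd i" for i
    using that cQ(1)[OF \<tau>(3) \<tau>1] by (auto simp: T_def)
  show ?thesis
  proof (rule that[of T])
    show "T 0 = P" by (simp add: T_def)
    show "T i \<in> lmeasurable \<and> T i \<subseteq> {0..<M} \<and> measure lebesgue (T i) = \<tau> i" for i
      using P \<tau>(1) cP(1)[OF \<tau>(3) \<tau>1, of i] cQ(1)[OF \<tau>(3) \<tau>1, of i] \<open>Q \<subseteq> {0..<M}\<close> by (auto simp: T_def)
    show "T i = {}" if "\<tau> i = 0" for i using that \<tau>(1) by (auto simp: T_def)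
    show "T i \<inter> T (Suc i) = {}" for i
      using T_even[of i] T_odd[of i] T_even[of "Suc i"] T_odd[of "Suc i"] Q(1) by (cases "even i") auto
    show "T (Suc (Suc i)) \<subseteq> T i" for i
    proof (cases "i = 0")
      case False
      then show ?thesis
        using dec[of i] \<tau>(3)[of i] \<tau>(3)[of "Suc (Suc i)"] \<tau>1[of i] cP(2)[of "\<tau> (Suc (Suc i))" "\<tau> i"]
          cQ(2)[of "\<tau> (Suc (Suc i))" "\<tau> i"]
        by (auto simp: T_def)
    qed (use T_even[of 2] in \<open>simp add: T_def numeral_2_eq_2\<close>)
  qed
qed

text \<open>The exponents 2j and 2j + 1 are paired. For x = k - 1 the factor 1 + x is k, which turns
  the hypothesis on \<epsilon>, stated with even powers, into one on the full geometric sum.\<close>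

lemma geometric_sum_pairs:
  fixes x :: real
  shows "(\<Sum>j<2 * m. x ^ j) = (1 + x) * (\<Sum>j<m. x ^ (2 * j))"
  by (induction m) (auto simp: algebra_simps)

section \<open>Recolouring the balls around the precoloured vertices\<close>

theorem mainTheorem16:
  fixes V :: "'a set" and E :: "'a \<Rightarrow> 'a \<Rightarrow> bool" and W :: "'a set"
    and d :: nat and k \<epsilon> :: real and p :: "'a \<Rightarrow> real set"
  assumes "d \<ge> 5" and "d mod 4 = 1"
    and "k \<in> \<rat>"
    and "2 \<le> k" and "k < 2 + 1 / (2 * real (d div 4) - 1)"
    and "\<epsilon> > 0"
    and "\<epsilon> * k * (\<Sum>j<d div 4. (k - 1) ^ (2 * j)) \<ge> 1"
    and "finite_simple_graph V E"
    and "fractionally_colorable V E k"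
    and "W \<subseteq> V"
    and "\<forall>u\<in>W. \<forall>v\<in>W. u \<noteq> v \<longrightarrow> dist_at_least E d u v"
    and "fractional_precoloring W (k + \<epsilon>) p"
  shows "precoloring_extends V E W (k + \<epsilon>) p"
proof -
  define n where "n = 2 * (d div 4)"
  define M where "M = k + \<epsilon>"
  have d: "d = 2 * n + 1" "n \<ge> 2" using assms(1,2) unfolding n_def by presburger+
  \<comment> \<open>For i < n, the drift along a walk of length 2i thus stays below one, the measure
    of a whole colour set.\<close>
  have kn: "real (n - 1) * (k - 2) < 1"
  proof -
    have "real (n - 1) = 2 * real (d div 4) - 1" "2 * real (d div 4) - 1 > 0"
      using d(2) by (simp_all add: n_def of_nat_diff)
    moreover have "q * (k - 2) < 1" if "q > 0" "k < 2 + 1 / q" for q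
      using that by (simp add: field_simps)
    ultimately show ?thesis using assms(5) by metis
  qed
  have V: "finite V" "\<And>u v. E u v \<Longrightarrow> u \<in> V \<and> v \<in> V \<and> u \<noteq> v \<and> E v u"
    using assms(8) by (auto simp: finite_simple_graph_def)
  obtain f where f: "fractional_coloring V E k f"
    using assms(9) by (auto simp: fractionally_colorable_def)
  have fV: "f v \<in> lmeasurable" "f v \<subseteq> {0..<k}" "measure lebesgue (f v) = 1" if "v \<in> V" for v
    using f that by (auto simp: fractional_coloring_def frac_color_set_iff)
  have fE: "f u \<inter> f v = {}" if "E u v" for u v
    using f that by (auto simp: fractional_coloring_def)
  have pW: "p w \<in> lmeasurable" "p w \<subseteq> {0..<M}" "measure lebesgue (p w) = 1" if "w \<in> W" for w
    using assms(12) that by (auto simp: fractional_precoloring_def frac_color_set_iff M_def)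

  \<comment> \<open>This is the closed form of the backward recursion t_i = \<epsilon> + (k - 1)
    t_(i+1) with t_n = 0, truncated at one because the chains live inside sets of measure one.
    Natural subtraction makes it vanish for all i \<ge> n.\<close>
  define \<tau> where "\<tau> i = min 1 (\<epsilon> * (\<Sum>j<n - i. (k - 1) ^ j))" for i
  have \<tau>_nonneg: "0 \<le> \<tau> i" for i
    using assms(4,6) by (auto simp: \<tau>_def intro!: sum_nonneg mult_nonneg_nonneg)
  have \<tau>_mono: "antimono \<tau>"
    unfolding \<tau>_def using assms(4,6)
    by (intro antimonoI min.mono mult_left_mono sum_mono2) auto
  have \<tau>_0: "\<tau> 0 = 1"
    using assms(7) geometric_sum_pairs[of "k - 1" "d div 4"] by (simp add: \<tau>_def n_def mult_ac)
  have \<tau>_n: "\<tau> n = 0" by (simp add: \<tau>_def)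
  \<comment> \<open>Splitting off the constant term of the sum gives the recursion. Truncation does
    no harm: if \<open>\<tau> (Suc i)\<close> is one, the right side is \<epsilon> + (k - 1) \<ge>
    1.\<close>
  have \<tau>_step: "\<tau> i \<le> \<epsilon> + (k - 1) * \<tau> (Suc i)" for i
  proof (cases "i < n")
    case True
    let ?s = "\<Sum>j<n - Suc i. (k - 1) ^ j"
    have "n - i = Suc (n - Suc i)" using True by simp
    then have "(\<Sum>j<n - i. (k - 1) ^ j) = 1 + (k - 1) * ?s"
      by (simp only: sum.lessThan_Suc_shift) (simp add: sum_distrib_left)
    then have \<tau>_i: "\<tau> i = min 1 (\<epsilon> + (k - 1) * (\<epsilon> * ?s))"
      by (simp only: \<tau>_def distrib_left mult_1_right mult.left_commute)
    show ?thesis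
    proof (cases "\<epsilon> * ?s \<le> 1")
      case True
      then have "\<tau> (Suc i) = \<epsilon> * ?s" by (simp add: \<tau>_def)
      then show ?thesis unfolding \<tau>_i by simp
    next
      case False
      then have "\<tau> (Suc i) = 1" by (simp add: \<tau>_def)
      moreover have "1 \<le> \<epsilon> + (k - 1)" using assms(4,6) by simp
      ultimately show ?thesis unfolding \<tau>_i by (simp add: min.coboundedI1)
    qed
  next
    case False
    then show ?thesis using assms(4,6) \<tau>_nonneg[of "Suc i"] by (simp add: \<tau>_def)
  qed

  have "\<exists>T. T 0 = p w \<and>
      (\<forall>i. T i \<in> lmeasurable \<and> T i \<subseteq> {0..<M} \<and> measure lebesgue (T i) = \<tau> i) \<and>
      (\<forall>i. \<tau> i = 0 \<longrightarrow> T i = {}) \<and> (\<forall>i. T i \<inter> T (Suc i) = {}) \<and> (\<forall>i. T (Suc (Suc i)) \<subseteq> T i)"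
    if "w \<in> W" for w
    using alternating_nested_sets[OF pW[OF that] _ \<tau>_0 \<tau>_mono \<tau>_nonneg] assms(4,6)
    unfolding M_def by (metis add_increasing2 less_imp_le)
  then obtain T where T_0: "\<And>w. w \<in> W \<Longrightarrow> T w 0 = p w"
    and T: "\<And>w i. w \<in> W \<Longrightarrow> T w i \<in> lmeasurable \<and> T w i \<subseteq> {0..<M} \<and> measure lebesgue (T w i) = \<tau> i"
    and T_empty: "\<And>w i. w \<in> W \<Longrightarrow> \<tau> i = 0 \<Longrightarrow> T w i = {}"
    and T_disj: "\<And>w i. w \<in> W \<Longrightarrow> T w i \<inter> T w (Suc i) = {}"
    and T_nest: "\<And>w i. w \<in> W \<Longrightarrow> T w (Suc (Suc i)) \<subseteq> T w i"
    by metis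
  \<comment> \<open>These are the colours of \<open>g v\<close> that are kept at distance i. At i =
    0 the choice \<open>p w\<close> makes the kept part and the added part
    \<open>T w 0 - g w\<close> unite to exactly \<open>p w\<close>.\<close>
  define S where "S w i = (case i of 0 \<Rightarrow> p w | Suc j \<Rightarrow> {0..<M} - T w j)" for w i

  \<comment> \<open>R w i v: w is the (unique) vertex of W at distance at most n from v, and that distance is i.\<close>
  define R where "R w i v \<longleftrightarrow> w \<in> W \<and> i \<le> n \<and> walk_of_length E i w v \<and> (\<forall>j<i. \<not> walk_of_length E j w v)"
    for w i v
  have R_W: "w \<in> W" if "R w i v" for w i v using that by (simp add: R_def)
  have R_unique: "w = w' \<and> i = i'" if R: "R w i v" "R w' i' v" for w i w' i' v
  proof
    have "walk_of_length E (i + i') w w'"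
      using R walk_sym[OF assms(8)] walk_trans by (metis R_def)
    moreover have "i + i' < d" using R d by (simp add: R_def)
    ultimately show "w = w'"
      using assms(11) R by (auto simp: R_def dist_at_least_def)
    then show "i = i'" using R by (meson R_def linorder_neqE_nat)
  qed
  have R_0: "R w 0 w" if "w \<in> W" for w
    using that by (simp add: R_def walk_0)
  have R_V: "v \<in> W" if "R w 0 v" for w v
    using that by (auto simp: R_def walk_0)
  \<comment> \<open>The assumption i < n keeps the neighbour v inside the ball of radius n. Its
    distance j from w differs from i by at most one, so only j = i remains to be excluded.\<close>
  have R_step: "\<exists>j. R w j v \<and> (j = Suc i \<or> i = Suc j)" if "R w i u" "E u v" "i < n" for w i u v
  proof -
    have ext: "walk_of_length E (Suc i') w y" if "walk_of_length E i' w x" "E x y" for i' x y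
      using walk_trans[OF that(1), of 1 y] that(2) walk_1[of E x y] by simp
    define j where "j = (LEAST j. walk_of_length E j w v)"
    have j_walk: "walk_of_length E j w v"
      unfolding j_def using ext that by (metis LeastI R_def)
    have "walk_of_length E (Suc i) w v" using ext that by (auto simp: R_def)
    then have "j \<le> Suc i" unfolding j_def by (rule Least_le)
    moreover have "\<forall>l<j. \<not> walk_of_length E l w v"
      unfolding j_def using not_less_Least by blast
    ultimately have Rj: "R w j v"
      using that(1,3) j_walk by (simp add: R_def)
    have "\<not> Suc j < i"
      using ext[OF j_walk, of u] V(2)[OF that(2)] that(1) unfolding R_def by blast
    \<comment> \<open>Going from u to v through w takes 2i steps, so \<open>f v - f u\<close> would
      have measure less than one. But u and v are adjacent, so this difference is all of
      \<open>f v\<close>.\<close>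
    moreover have "j \<noteq> i"
    proof
      assume "j = i"
      then have "walk_of_length E (2 * i) u v"
        using walk_trans[OF walk_sym[OF assms(8)] j_walk, of i u] that(1) by (simp add: R_def mult_2)
      then have "measure lebesgue (f v - f u) \<le> real i * (k - 2)"
        using coloring_drift_even_walk[OF assms(8) f] V(2)[OF that(2)] by blast
      moreover have "f v - f u = f v" using fE[OF that(2)] by auto
      moreover have "real i * (k - 2) \<le> real (n - 1) * (k - 2)"
        using \<open>i < n\<close> assms(4) by (intro mult_right_mono) auto
      ultimately show False using fV(3) V(2)[OF that(2)] kn by auto
    qed
    ultimately show ?thesis using Rj \<open>j \<le> Suc i\<close> by (intro exI[of _ j]) auto
  qed

  \<comment> \<open>Equidistribution is required against all chain members, and against [0,M) itself
    in order to fix the measure of \<open>g v\<close>.\<close>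
  define \<T> where "\<T> = insert {0..<M} ((\<lambda>(w, i). T w i) ` (W \<times> {..n}))"
  have fin: "finite \<T>" using finite_subset[OF assms(10) V(1)] by (simp add: \<T>_def)
  have lm: "A \<in> lmeasurable \<and> A \<subseteq> {0..<M}" if A: "A \<in> \<T>" for A
  proof -
    consider "A = {0..<M}" | w i where "w \<in> W" "A = T w i"
      using A by (auto simp: \<T>_def)
    then show ?thesis using T lmeasurable_atLeastLessThan by cases simp_all
  qed
  have "0 < k" using assms(4) by simp
  obtain g where g: "\<And>v. v \<in> V \<Longrightarrow> g v \<in> lmeasurable \<and> g v \<subseteq> {0..<M}"
    and g_disj: "\<And>u v. u \<in> V \<Longrightarrow> v \<in> V \<Longrightarrow> f u \<inter> f v = {} \<Longrightarrow> g u \<inter> g v = {}"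
    and g_meas: "\<And>v A. v \<in> V \<Longrightarrow> A \<in> \<T> \<Longrightarrow>
       measure lebesgue (g v \<inter> A) = measure lebesgue (f v) / k * measure lebesgue A"
    by (rule equidistributed_copy[OF fin lm V(1) conjI[OF fV(1,2)] \<open>0 < k\<close>]) blast+

  \<comment> \<open>The quantifiers avoid choosing w and i: outside all balls they are vacuous and F
    is g, and inside a ball uniqueness reduces them to a single pair.\<close>
  define F where "F v = {x \<in> {0..<M}. if x \<in> g v then \<forall>w i. R w i v \<longrightarrow> x \<in> S w i
                                        else \<exists>w i. R w i v \<and> x \<in> T w i}" for v
  have F_level: "F v = (g v \<inter> S w i) \<union> (T w i - g v)" if "R w i v" "v \<in> V" for w i v
  proof -
    have "(\<forall>w' i'. R w' i' v \<longrightarrow> x \<in> S w' i') \<longleftrightarrow> x \<in> S w i"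
      "(\<exists>w' i'. R w' i' v \<and> x \<in> T w' i') \<longleftrightarrow> x \<in> T w i" for x
      using that(1) R_unique[OF that(1)] by blast+
    then show ?thesis
      using g[OF that(2)] T[OF R_W[OF that(1)], of i] by (auto simp: F_def split: if_splits)
  qed
  \<comment> \<open>At distance n the chain has reached the empty set and nothing is added. Edges
    between two boundary vertices, or leaving a ball, are therefore handled by g alone.\<close>
  have F_far: "F v \<subseteq> g v" if "\<And>w i. R w i v \<Longrightarrow> i = n" for v
  proof (rule subsetI, rule ccontr)
    fix x assume "x \<in> F v" "x \<notin> g v"
    then obtain w i where "R w i v" "x \<in> T w i" by (auto simp: F_def)
    then show False using that T_empty[OF R_W \<tau>_n] by fastforce
  qed
  have F_W: "F w = p w" if "w \<in> W" for w
    using F_level[OF R_0[OF that]] that assms(10) T_0[OF that] by (auto simp: S_def)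
  \<comment> \<open>Kept parts are disjoint because g respects edges, added parts because
    consecutive chain members are disjoint. Colours kept at i avoid \<open>T w (Suc i)\<close> by
    nesting (by \<open>T_disj\<close> when i = 0), and those kept at i + 1 avoid
    \<open>T w i\<close> by the definition of \<open>S\<close>.\<close>
  have F_consecutive: "F u \<inter> F v = {}" if "R w i u" "R w (Suc i) v" "E u v" for w i u v
  proof -
    have w: "w \<in> W" using R_W that by blast
    have "S w i \<inter> T w (Suc i) = {}"
    proof (cases i)
      case 0
      then show ?thesis using T_disj[OF w, of 0] T_0[OF w] by (simp add: S_def)
    next
      case (Suc j)
      then show ?thesis using T_nest[OF w, of j] by (auto simp: S_def)
    qed
    moreover have "S w (Suc i) \<inter> T w i = {}" by (auto simp: S_def)
    moreover have "g u \<inter> g v = {}" using g_disj fE V(2) that by blast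
    ultimately show ?thesis
      using F_level[OF that(1)] F_level[OF that(2)] V(2)[OF that(3)] T_disj[OF w, of i] by auto
  qed
  have F_inner: "F u \<inter> F v = {}" if "R w i u" "i < n" "E u v" for w i u v
    using R_step[OF that(1,3,2)] F_consecutive that V(2)[OF that(3)] by blast
  have F_disj: "F u \<inter> F v = {}" if "E u v" for u v
  proof (cases "\<exists>w i. i < n \<and> (R w i u \<or> R w i v)")
    case True
    then show ?thesis using F_inner that V(2)[OF that] by blast
  next
    case False
    then have "F u \<subseteq> g u" "F v \<subseteq> g v"
      by (intro F_far; metis R_def le_neq_implies_less)+
    then show ?thesis using g_disj fE V(2) that by blast
  qed
  have gM: "measure lebesgue (g v) = M / k" if v: "v \<in> V" for v
  proof -
    have "{0..<M} \<in> \<T>" "g v \<inter> {0..<M} = g v" using g[OF v] by (auto simp: \<T>_def)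
    then show ?thesis
      using g_meas[OF v, of "{0..<M}"] fV(3)[OF v] assms(4,6) by (simp add: M_def)
  qed
  have F_meas: "F v \<in> lmeasurable \<and> F v \<subseteq> {0..<M} \<and> 1 \<le> measure lebesgue (F v)" if v: "v \<in> V" for v
  proof (cases "\<exists>w i. R w i v")
    case False
    then have "F v = g v" using g[OF v] by (auto simp: F_def)
    then show ?thesis using g[OF v] gM[OF v] assms(4,6) by (simp add: M_def)
  next
    case True
    then obtain w i where R: "R w i v" by blast
    then have w: "w \<in> W" and i: "i \<le> n" by (auto simp: R_def)
    show ?thesis
    proof (cases i)
      case 0
      then have "v \<in> W" using R R_V by blast
      then show ?thesis using F_W pW by simp
    next
      case (Suc j)
      have "T w l \<in> \<T>" if "l \<le> n" for l
        unfolding \<T>_def using w that by (intro insertI2 image_eqI[of _ _ "(w, l)"]) auto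
      then have T_in: "T w j \<in> \<T>" "T w i \<in> \<T>" using i Suc by simp_all
      have F: "F v = (g v - T w j) \<union> (T w i - g v)"
        unfolding F_level[OF R v] using g[OF v] by (auto simp: S_def Suc)
      have lm: "g v - T w j \<in> lmeasurable" "T w i - g v \<in> lmeasurable"
        using g[OF v] T[OF w, of i] T[OF w, of j] by (simp_all add: fmeasurable.Diff)
      have diff: "measure lebesgue (A - B) = measure lebesgue A - measure lebesgue (A \<inter> B)"
        if "A \<in> lmeasurable" "B \<in> lmeasurable" for A B :: "real set"
        using measurable_measure_Diff[of A lebesgue "A \<inter> B"] that
        by (simp add: Diff_Int fmeasurableD)
      have "measure lebesgue (F v) = measure lebesgue (g v - T w j) + measure lebesgue (T w i - g v)"
      proof -
        have "(g v - T w j) \<inter> (T w i - g v) = {}" by blast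
        then show ?thesis unfolding F using measure_Un3[OF lm] by simp
      qed
      \<comment> \<open>By equidistribution, g loses the fraction 1/k of \<open>T w j\<close> and
        gains the fraction 1 - 1/k of \<open>T w i\<close>. With M = k + \<epsilon>, the total is at
        least one exactly when the inequality \<open>\<tau>_step\<close> holds at j.\<close>
      also have "\<dots> = (M / k - \<tau> j / k) + (\<tau> i - \<tau> i / k)"
        using g[OF v] T[OF w, of i] T[OF w, of j] diff[of "g v" "T w j"] diff[of "T w i" "g v"]
          g_meas[OF v T_in(1)] g_meas[OF v T_in(2)] fV(3)[OF v] gM[OF v]
        by (simp add: Int_commute)
      also have "\<dots> = (M - \<tau> j + (k - 1) * \<tau> i) / k"
        using assms(4) by (simp add: field_simps)
      also have "\<dots> \<ge> 1"
        using \<tau>_step[of j] Suc assms(4) by (simp add: M_def)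
      finally show ?thesis
        using lm g[OF v] T[OF w, of i] unfolding F by (auto intro: fmeasurable.Un)
    qed
  qed
  \<comment> \<open>F may have measure above one. Shrinking it preserves disjointness, and on W it
    already equals the precolouring.\<close>
  have "\<exists>B. B \<subseteq> F v \<and> frac_color_set M B \<and> (v \<in> W \<longrightarrow> B = p v)" if v: "v \<in> V" for v
  proof (cases "v \<in> W")
    case True
    then show ?thesis using F_W pW by (auto simp: frac_color_set_iff)
  next
    case False
    then show ?thesis
      using subset_of_measure[of "F v" 0 M 1] F_meas[OF v] by (metis frac_color_set_iff subset_trans zero_le_one)
  qed
  then obtain h where h: "\<And>v. v \<in> V \<Longrightarrow> h v \<subseteq> F v \<and> frac_color_set M (h v) \<and> (v \<in> W \<longrightarrow> h v = p v)"
    by metis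
  have "fractional_coloring V E M h"
    unfolding fractional_coloring_def using h F_disj V(2) by (meson disjoint_iff subset_iff)
  then show ?thesis
    unfolding precoloring_extends_def M_def[symmetric] using h assms(10) by blast
qed

end
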